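(* For any $\varepsilon\in(0,2\pi/3)$ and any integer $d\geq 2$, \[F_d(\varepsilon,n)=O\left(\left(\frac{\cos(\varepsilon/2)}{\sin(\pi/3-\varepsilon/2)}\right)^n\right)\qquad\text{as } n\to\infty,\] with $\varepsilon$ and $d$ fixed.
   Context: A Steiner topology for $n$ terminals is a (graph-theoretic) tree $\mathcal{T}$ with $n$ special vertices $t_1,\dots,t_n$, called terminals, all of degree at most $3$, and all other vertices, called Steiner points, of degree exactly $3$. It is full if all terminals have degree $1$. Given a family $p_1,\dots,p_n$ of points in $\mathbb{R}^d$ (repetitions allowed), a Steiner tree with topology $\mathcal{T}$ on these points is a representation of $\mathcal{T}$ in $\mathbb{R}^d$ in which $t_i$ is represented by $p_i$, each Steiner point by an arbitrary point of $\mathbb{R}^d$, and each edge by a straight-line segment; points may coincide (so edges may have length $0$; such edges, and trees containing them, are called degenerate) and edges may cross. The length $L(T)$ is the sum of the Euclidean lengths of the edges. Angles are measured in $[0,\pi]$. For $\varepsilon\geq 0$, an $\varepsilon$-approximate Steiner tree is a tree with a Steiner topology such that at each Steiner point all three angles spanned by pairs of incident edges belong to $[2\pi/3-\varepsilon,2\pi/3+\varepsilon]$ (in particular these angles are defined, so edges at Steiner points have positive length). $\mathcal{A}_\varepsilon^d(n)$ denotes the set of all $\varepsilon$-approximate Steiner trees in $\mathbb{R}^d$ with full Steiner topology on $n$ terminals. For a tree $T$ in $\mathbb{R}^d$ with Steiner topology $\mathcal{T}$, $S(T)$ denotes the (unique) shortest tree in $\mathbb{R}^d$ on the terminals of $T$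 with topology $\mathcal{T}$, where degenerate trees are allowed. Define \[F_d(\varepsilon,n)=\sup\left\{\frac{L(T)-L(S(T))}{L(S(T))}: T\in\mathcal{A}_\varepsilon^d(n)\right\}.\] *)

theory Defs
  imports "HOL-Analysis.Analysis" "HOL-Library.Landau_Symbols"
begin

section \<open>Finite trees\<close>

text \<open>
  Finite simple undirected graphs, given by a vertex set and a set of two-element edges. Vertices
  are natural numbers, which loses no generality: every finite graph is isomorphic to one of these.
  (The notion of a tree in the AFP entry Graph\_Theory only excludes directed cycles, so it is not
  the notion for undirected graphs.)
\<close>

definition simple_graph :: "nat set \<Rightarrow> nat set set \<Rightarrow> bool" where
  "simple_graph V E \<longleftrightarrow>
     finite V \<and> (\<forall>e\<in>E. \<exists>u v. u \<in> V \<and> v \<in> V \<and> u \<noteq> v \<and> e = {u, v})"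

definition graph_connected :: "nat set \<Rightarrow> nat set set \<Rightarrow> bool" where
  "graph_connected V E \<longleftrightarrow>
     V \<noteq> {} \<and> (\<forall>u\<in>V. \<forall>v\<in>V. (u, v) \<in> {(a, b). {a, b} \<in> E}\<^sup>*)"

definition graph_cycle :: "nat set set \<Rightarrow> nat list \<Rightarrow> bool" where
  "graph_cycle E c \<longleftrightarrow>
     length c \<ge> 3 \<and> distinct c \<and>
     (\<forall>i<length c. {c ! i, c ! (Suc i mod length c)} \<in> E)"

definition graph_tree :: "nat set \<Rightarrow> nat set set \<Rightarrow> bool" where
  "graph_tree V E \<longleftrightarrow>
     simple_graph V E \<and> graph_connected V E \<and> \<not> (\<exists>c. graph_cycle E c)"

definition degree_in :: "nat set set \<Rightarrow> nat \<Rightarrow> nat" where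
  "degree_in E v = card {e \<in> E. v \<in> e}"


section \<open>Steiner topologies and Steiner trees\<close>

text \<open>The terminals are \<open>term_at \<tau> 1, \<dots>, term_at \<tau> n\<close>.\<close>

record topology =
  verts :: "nat set"
  edges :: "nat set set"
  term_at :: "nat \<Rightarrow> nat"

definition steiner_points :: "nat \<Rightarrow> topology \<Rightarrow> nat set" where
  "steiner_points n \<tau> = verts \<tau> - term_at \<tau> ` {1..n}"

definition steiner_topology :: "nat \<Rightarrow> topology \<Rightarrow> bool" where
  "steiner_topology n \<tau> \<longleftrightarrow>
     graph_tree (verts \<tau>) (edges \<tau>) \<and>
     inj_on (term_at \<tau>) {1..n} \<and> term_at \<tau> ` {1..n} \<subseteq> verts \<tau> \<and>
     (\<forall>i\<in>{1..n}. degree_in (edges \<tau>) (term_at \<tau> i) \<le> 3) \<and>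
     (\<forall>s\<in>steiner_points n \<tau>. degree_in (edges \<tau>) s = 3)"

definition full_steiner_topology :: "nat \<Rightarrow> topology \<Rightarrow> bool" where
  "full_steiner_topology n \<tau> \<longleftrightarrow>
     steiner_topology n \<tau> \<and> (\<forall>i\<in>{1..n}. degree_in (edges \<tau>) (term_at \<tau> i) = 1)"

text \<open>
  A Steiner tree is a pair of a topology and a map from its vertices to points. The map is total on
  \<^typ>\<open>nat\<close>, but only its values on the vertices of the topology matter. It need not be injective, so
  degenerate trees are included. The condition \<open>u < v\<close> counts each edge once.
\<close>

type_synonym 'd steiner_tree = "topology \<times> (nat \<Rightarrow> real ^ 'd)"

definition tree_length :: "'d::finite steiner_tree \<Rightarrow> real" where
  "tree_length T =
     (\<Sum>(u, v) | u < v \<and> {u, v} \<in> edges (fst T). dist (snd T u) (snd T v))"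

text \<open>The angle at \<open>q\<close> in \<open>[0, \<pi>]\<close>; meaningful only if \<open>p\<close> and \<open>r\<close> differ from \<open>q\<close>.\<close>

definition angle_at :: "real ^ 'd::finite \<Rightarrow> real ^ 'd \<Rightarrow> real ^ 'd \<Rightarrow> real" where
  "angle_at p q r = arccos (((p - q) \<bullet> (r - q)) / (norm (p - q) * norm (r - q)))"

definition approx_steiner_tree :: "real \<Rightarrow> nat \<Rightarrow> 'd::finite steiner_tree \<Rightarrow> bool" where
  "approx_steiner_tree \<epsilon> n T \<longleftrightarrow>
     steiner_topology n (fst T) \<and>
     (\<forall>s\<in>steiner_points n (fst T).
        (\<forall>a. {s, a} \<in> edges (fst T) \<longrightarrow> snd T a \<noteq> snd T s) \<and>
        (\<forall>a b. {s, a} \<in> edges (fst T) \<longrightarrow> {s, b} \<in> edges (fst T) \<longrightarrow> a \<noteq> b \<longrightarrow>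
           angle_at (snd T a) (snd T s) (snd T b) \<in> {2 * pi / 3 - \<epsilon> .. 2 * pi / 3 + \<epsilon>}))"

definition full_approx_steiner_trees :: "real \<Rightarrow> nat \<Rightarrow> ('d::finite steiner_tree) set" where
  "full_approx_steiner_trees \<epsilon> n =
     {T. approx_steiner_tree \<epsilon> n T \<and> full_steiner_topology n (fst T)}"

text \<open>
  The shortest tree with the topology and the terminals of \<open>T\<close>, degenerate trees allowed. When
  terminals are repeated there can be several shortest trees; they all have the same length, and
  only the length is used below.
\<close>

definition shortest_tree :: "nat \<Rightarrow> 'd::finite steiner_tree \<Rightarrow> 'd steiner_tree" where
  "shortest_tree n T =
     arg_min tree_length
       (\<lambda>T'. fst T' = fst T \<and>
             (\<forall>i\<in>{1..n}. snd T' (term_at (fst T) i) = snd T (term_at (fst T) i)))"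

text \<open>
  The supremum is taken in the extended reals, so that an unbounded family gives \<open>\<infinity>\<close>. The
  denominator can vanish only for \<open>n = 2\<close> when \<open>\<epsilon> < 2\<pi>/3\<close>: for \<open>n \<ge> 3\<close>, two terminals adjacent
  to the same Steiner point span a positive angle there and so are at distinct points. The argument
  of type \<^typ>\<open>'d itself\<close> determines the dimension of the space.
\<close>

definition max_relative_error :: "'d::finite itself \<Rightarrow> real \<Rightarrow> nat \<Rightarrow> ereal" where
  "max_relative_error _ \<epsilon> n =
     (SUP T \<in> (full_approx_steiner_trees \<epsilon> n :: ('d steiner_tree) set).
        ereal ((tree_length T - tree_length (shortest_tree n T)) /
               tree_length (shortest_tree n T)))"

end

theory Submission
  imports Defs
begin

text \<open>
  Let \<open>\<sigma> = sin (\<pi>/3 - \<epsilon>/2)\<close>. A pair of edges of lengths \<open>a\<close> and \<open>b\<close> that meet at an angle of at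
  least \<open>2\<pi>/3 - \<epsilon>\<close> satisfies \<open>\<sigma> (a + b) \<le> d\<close>, where \<open>d\<close> is the distance of their other ends. This is
  all that is needed of the angle condition, and the rest of the argument works in any metric space:
  if \<open>X\<close> is an approximate Steiner tree with \<open>n\<close> terminals and \<open>Y\<close> any tree with the same topology
  and the same terminals, then \<open>L(X) \<le> K\<^sub>n L(Y)\<close>, where \<open>K\<^sub>n\<close> grows like \<open>\<mu>\<^sup>n\<close> for
  \<open>\<mu> = (1 + 1/\<sigma>)/2\<close>.

  The proof is by induction on \<open>n\<close>. Some Steiner point \<open>s\<close> is adjacent to two terminals, \<open>p\<close> and
  \<open>q\<close>. Delete these, make \<open>s\<close> a terminal at its position \<open>X s\<close>, and let \<open>Y'\<close> be the rest of \<open>Y\<close>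
  with \<open>s\<close> moved from \<open>Y s\<close> to \<open>X s\<close>. Averaging the triangle inequalities through \<open>p\<close> and through
  \<open>q\<close> bounds the distance moved by half of the total length of the four edges at \<open>p\<close> and \<open>q\<close>, two
  in each tree, so that, with \<open>d\<close> the distance of \<open>p\<close> and \<open>q\<close>,
  \<open>L(Y') \<le> L(Y) + (1/\<sigma> - 1) d / 2 = L(Y) + (\<mu> - 1) d\<close>. The two edges lost from \<open>X\<close> have total
  length at most \<open>d / \<sigma>\<close>, and \<open>d \<le> L(Y)\<close>. Hence \<open>K\<^sub>n = \<mu> K\<^sub>n\<^sub>-\<^sub>1 + 1/\<sigma>\<close> is good enough; this is
  \<open>graph_length_comparison\<close>.

  Finally \<open>\<mu> \<le> cos (\<epsilon>/2) / \<sigma>\<close>, by \<open>growth_rate_le\<close>, and the shortest tree, whose existence is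
  a compactness argument (\<open>shortest_realization_exists\<close>), can be taken for \<open>Y\<close>.
\<close>

section \<open>Forests whose vertices have degree one or three\<close>

text \<open>
  The edge sets of full Steiner topologies, without connectedness, which plays no role in the
  induction. There is no separate vertex set: numbers outside \<open>\<Union>E\<close> have degree 0.
\<close>

definition cubic_forest :: "nat set set \<Rightarrow> bool" where
  "cubic_forest E \<longleftrightarrow>
     finite E \<and> (\<forall>e\<in>E. \<exists>u v. u \<noteq> v \<and> e = {u, v}) \<and> \<not> (\<exists>c. graph_cycle E c) \<and>
     (\<forall>v. degree_in E v \<in> {0, 1, 3})"

definition leaves :: "nat set set \<Rightarrow> nat set" where
  "leaves E = {v. degree_in E v = 1}"

lemma cubic_forestD:
  assumes "cubic_forest E"
  shows "finite E" "e \<in> E \<Longrightarrow> \<exists>u v. u \<noteq> v \<and> e = {u, v}" "\<not> graph_cycle E c"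
    "degree_in E v = 0 \<or> degree_in E v = 1 \<or> degree_in E v = 3"
  using assms unfolding cubic_forest_def by auto

lemma cubic_forest_edge_neq:
  assumes "cubic_forest E" "{u, v} \<in> E"
  shows "u \<noteq> v"
  using cubic_forestD(2)[OF assms] by auto

lemma finite_Union_edges:
  assumes "cubic_forest E"
  shows "finite (\<Union>E)"
proof (rule finite_Union)
  show "finite E" using assms by (rule cubic_forestD)
  show "finite e" if "e \<in> E" for e
    using cubic_forestD(2)[OF assms that] by auto
qed

lemma finite_leaves:
  assumes "cubic_forest E"
  shows "finite (leaves E)"
proof (rule finite_subset[OF _ finite_Union_edges[OF assms]])
  show "leaves E \<subseteq> \<Union>E"
  proof
    fix v assume "v \<in> leaves E"
    then have "{e \<in> E. v \<in> e} \<noteq> {}"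
      unfolding leaves_def degree_in_def by force
    then show "v \<in> \<Union>E" by auto
  qed
qed

lemma degree_in_eq_card_neighbours:
  assumes "cubic_forest E"
  shows "degree_in E v = card {w. {v, w} \<in> E}"
proof -
  have "bij_betw (\<lambda>w. {v, w}) {w. {v, w} \<in> E} {e \<in> E. v \<in> e}"
    unfolding bij_betw_def
  proof
    show "inj_on (\<lambda>w. {v, w}) {w. {v, w} \<in> E}"
      by (auto simp: inj_on_def doubleton_eq_iff)
    have "\<exists>w. {v, w} \<in> E \<and> e = {v, w}" if "e \<in> E" "v \<in> e" for e
    proof -
      obtain a b where "e = {a, b}" using cubic_forestD(2)[OF assms \<open>e \<in> E\<close>] by blast
      with that show ?thesis by (auto simp: insert_commute)
    qed
    then show "(\<lambda>w. {v, w}) ` {w. {v, w} \<in> E} = {e \<in> E. v \<in> e}" by auto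
  qed
  then show ?thesis
    unfolding degree_in_def by (simp add: bij_betw_same_card)
qed


section \<open>Two leaves at a common vertex\<close>

text \<open>A path is the list of its vertices, which are distinct.\<close>

definition graph_path :: "nat set set \<Rightarrow> nat list \<Rightarrow> bool" where
  "graph_path E xs \<longleftrightarrow> distinct xs \<and> successively (\<lambda>u v. {u, v} \<in> E) xs"

lemma graph_path_Cons:
  "graph_path E (x # y # zs) \<longleftrightarrow> {x, y} \<in> E \<and> x \<notin> set (y # zs) \<and> graph_path E (y # zs)"
  by (auto simp: graph_path_def)

lemma graph_path_appendD:
  assumes "graph_path E (xs @ ys)"
  shows "graph_path E xs"
  using assms by (auto simp: graph_path_def successively_append_iff)

lemma graph_cycle_closed_path:
  assumes "graph_path E xs" "length xs \<ge> 3" "{last xs, hd xs} \<in> E"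
  shows "graph_cycle E xs"
  unfolding graph_cycle_def
proof (intro conjI allI impI)
  show "3 \<le> length xs" "distinct xs"
    using assms by (auto simp: graph_path_def)
  fix i assume i: "i < length xs"
  show "{xs ! i, xs ! (Suc i mod length xs)} \<in> E"
  proof (cases "Suc i = length xs")
    case True
    then have "i = length xs - 1" "xs \<noteq> []" using assms(2) by auto
    then have "xs ! i = last xs" "xs ! 0 = hd xs"
      by (simp_all add: last_conv_nth hd_conv_nth)
    with True assms(3) show ?thesis by simp
  next
    case False
    with i have "Suc i < length xs" by simp
    with assms(1) show ?thesis
      by (simp add: graph_path_def successively_conv_nth)
  qed
qed

text \<open>
  In a forest, a neighbour of the first vertex of a path that lies on the path is its second vertex.
\<close>

lemma neighbour_of_hd_on_path:
  assumes E: "cubic_forest E" and path: "graph_path E (x # z # zs)"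
    and edge: "{x, y} \<in> E" and y: "y \<in> set (x # z # zs)"
  shows "y = z"
proof (rule ccontr)
  assume "y \<noteq> z"
  moreover have "y \<noteq> x" using cubic_forest_edge_neq[OF E edge] by simp
  ultimately have "y \<in> set zs" using y by simp
  then obtain as bs where zs: "zs = as @ y # bs" by (meson split_list)
  have "graph_path E (x # z # as @ [y])"
    by (rule graph_path_appendD[of _ _ bs]) (use path zs in simp)
  then have "graph_cycle E (x # z # as @ [y])"
    by (rule graph_cycle_closed_path) (use edge in \<open>auto simp: insert_commute\<close>)
  with cubic_forestD(3)[OF E] show False by blast
qed

lemma degree_hd_longest_path:
  assumes E: "cubic_forest E" and path: "graph_path E (x # z # zs)"
    and longest: "\<And>ys. graph_path E ys \<Longrightarrow> length ys \<le> length (x # z # zs)"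
  shows "degree_in E x = 1"
proof -
  have "y = z" if "{x, y} \<in> E" for y
  proof (cases "y \<in> set (x # z # zs)")
    case True
    then show ?thesis using neighbour_of_hd_on_path[OF E path that] by blast
  next
    case False
    moreover have "{y, x} \<in> E" using that by (simp add: insert_commute)
    ultimately have "graph_path E (y # x # z # zs)"
      using path unfolding graph_path_Cons by blast
    from longest[OF this] show ?thesis by simp
  qed
  moreover have "{x, z} \<in> E" using path by (simp add: graph_path_Cons)
  ultimately have "{w. {x, w} \<in> E} = {z}" by blast
  then show ?thesis by (simp add: degree_in_eq_card_neighbours[OF E])
qed

text \<open>
  The second vertex of a longest path is adjacent to two leaves: the first vertex, and the neighbour
  off the path, which can replace the first vertex.
\<close>

lemma two_leaves_at_common_vertex:
  assumes E: "cubic_forest E" and v: "degree_in E v = 3"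
  obtains s p q where "degree_in E s = 3" "p \<noteq> q" "{s, p} \<in> E" "{s, q} \<in> E"
    "p \<in> leaves E" "q \<in> leaves E"
proof -
  have "\<exists>T. T \<subseteq> {w. {v, w} \<in> E} \<and> card T = 2"
    by (rule obtain_subset_with_card_n[of 2 "{w. {v, w} \<in> E}"])
       (use v in \<open>auto simp: degree_in_eq_card_neighbours[OF E]\<close>)
  then obtain a b where ab: "{v, a} \<in> E" "{v, b} \<in> E" "a \<noteq> b"
    by (auto simp: card_2_iff)
  then have path0: "graph_path E [a, v, b]"
    using cubic_forest_edge_neq[OF E] by (auto simp: graph_path_def insert_commute)
  have bound: "length xs \<le> max 1 (card (\<Union>E))" if "graph_path E xs" for xs
  proof (cases "length xs \<le> 1")
    case False
    have "set xs \<subseteq> \<Union>E"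
    proof
      fix x assume "x \<in> set xs"
      then obtain i where i: "i < length xs" "x = xs ! i" by (auto simp: in_set_conv_nth)
      show "x \<in> \<Union>E"
      proof (cases "Suc i < length xs")
        case True
        then have "{xs ! i, xs ! Suc i} \<in> E"
          using that by (simp add: graph_path_def successively_conv_nth)
        with i show ?thesis by auto
      next
        case False
        with i \<open>\<not> length xs \<le> 1\<close> obtain j where j: "i = Suc j" by (cases i) auto
        then have "{xs ! j, xs ! Suc j} \<in> E"
          using that i by (simp add: graph_path_def successively_conv_nth)
        with i j show ?thesis by auto
      qed
    qed
    then have "card (set xs) \<le> card (\<Union>E)"
      by (rule card_mono[OF finite_Union_edges[OF E]])
    with that show ?thesis by (simp add: graph_path_def distinct_card)
  qed simp
  obtain xs where xs: "graph_path E xs"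
    and longest: "\<And>ys. graph_path E ys \<Longrightarrow> length ys \<le> length xs"
    using ex_has_greatest_nat[of "graph_path E" "[a, v, b]" length "Suc (max 1 (card (\<Union>E)))"]
      path0 bound by (auto simp: less_Suc_eq_le)
  have "length xs \<ge> 3" using longest[OF path0] by simp
  then obtain p s r zs where eq: "xs = p # s # r # zs"
    by (auto simp: numeral_3_eq_3 Suc_le_length_iff)
  have path: "graph_path E (p # s # r # zs)" using xs eq by simp
  then have path_tl: "graph_path E (s # r # zs)" and ps: "{s, p} \<in> E" and sr: "{s, r} \<in> E"
    and "p \<noteq> r"
    by (auto simp: graph_path_Cons insert_commute)
  have p: "degree_in E p = 1"
    using degree_hd_longest_path[OF E path] longest eq by simp
  have fin: "finite {w. {s, w} \<in> E}"
    by (rule finite_subset[OF _ finite_Union_edges[OF E]]) auto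
  have "card {p, r} \<le> card {w. {s, w} \<in> E}"
    by (rule card_mono[OF fin]) (use ps sr in auto)
  then have s: "degree_in E s = 3"
    using cubic_forestD(4)[OF E, of s] \<open>p \<noteq> r\<close>
    by (auto simp: degree_in_eq_card_neighbours[OF E])
  have "\<not> {w. {s, w} \<in> E} \<subseteq> {p, r}"
  proof
    assume "{w. {s, w} \<in> E} \<subseteq> {p, r}"
    then have "card {w. {s, w} \<in> E} \<le> card {p, r}" by (rule card_mono[rotated]) simp
    with s \<open>p \<noteq> r\<close> show False by (simp add: degree_in_eq_card_neighbours[OF E])
  qed
  then obtain q where q: "{s, q} \<in> E" "q \<noteq> p" "q \<noteq> r" by auto
  have "q \<notin> set (s # r # zs)"
    using neighbour_of_hd_on_path[OF E path_tl q(1)] q(3) by blast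
  moreover have "{q, s} \<in> E" using q(1) by (simp add: insert_commute)
  ultimately have "graph_path E (q # s # r # zs)"
    using path_tl unfolding graph_path_Cons by blast
  then have "degree_in E q = 1"
    by (rule degree_hd_longest_path[OF E]) (use longest eq in simp)
  with p s q ps show ?thesis by (intro that[of s p q]) (auto simp: leaves_def)
qed


section \<open>Removing two leaves\<close>

lemma degree_in_Diff:
  assumes "finite E" "F \<subseteq> E"
  shows "degree_in (E - F) v = degree_in E v - degree_in F v"
proof -
  have "{e \<in> E - F. v \<in> e} = {e \<in> E. v \<in> e} - {e \<in> F. v \<in> e}" by auto
  then show ?thesis
    unfolding degree_in_def
    using assms by (simp add: card_Diff_subset finite_subset Collect_mono_iff subset_iff)
qed

lemma degree_in_two_edges:
  assumes "s \<noteq> p" "s \<noteq> q" "p \<noteq> q"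
  shows "degree_in {{s, p}, {s, q}} v = (if v = s then 2 else if v = p \<or> v = q then 1 else 0)"
proof -
  have "{e \<in> {{s, p}, {s, q}}. v \<in> e} =
      (if v = s then {{s, p}, {s, q}} else if v = p then {{s, p}}
       else if v = q then {{s, q}} else {})"
    using assms by auto
  moreover have "{s, p} \<noteq> {s, q}" using assms by (simp add: doubleton_eq_iff)
  ultimately show ?thesis by (simp add: degree_in_def)
qed

text \<open>
  Only the edges are deleted, so the two leaves get degree 0, and their common neighbour becomes a
  leaf.
\<close>

lemma remove_two_leaves:
  assumes E: "cubic_forest E" and s: "degree_in E s = 3" and "p \<noteq> q"
    and edges: "{s, p} \<in> E" "{s, q} \<in> E" and pq: "p \<in> leaves E" "q \<in> leaves E"
  defines "E' \<equiv> E - {{s, p}, {s, q}}"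
  shows "cubic_forest E'" and "leaves E' = insert s (leaves E - {p, q})"
    and "\<And>v. degree_in E' v = 3 \<Longrightarrow> degree_in E v = 3"
    and "Suc (card (leaves E')) = card (leaves E)"
proof -
  have neq: "s \<noteq> p" "s \<noteq> q" using cubic_forest_edge_neq[OF E] edges by auto
  have deg: "degree_in E' v =
      (if v = s then 1 else if v = p \<or> v = q then 0 else degree_in E v)" for v
    unfolding E'_def
    using degree_in_Diff[of E "{{s, p}, {s, q}}" v] cubic_forestD(1)[OF E] edges
      degree_in_two_edges[OF neq \<open>p \<noteq> q\<close>, of v] s pq
    by (auto simp: leaves_def)
  have "graph_cycle E c" if "graph_cycle E' c" for c
    using that by (auto simp: graph_cycle_def E'_def)
  then show "cubic_forest E'"
    using E deg unfolding cubic_forest_def by (auto simp: E'_def)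
  show lv: "leaves E' = insert s (leaves E - {p, q})"
    using deg neq by (auto simp: leaves_def split: if_splits)
  show "degree_in E v = 3" if "degree_in E' v = 3" for v
    using that deg[of v] s by (auto split: if_splits)
  have "s \<notin> leaves E" using s by (simp add: leaves_def)
  moreover have "card {p, q} \<le> card (leaves E)"
    by (rule card_mono[OF finite_leaves[OF E]]) (use pq in simp)
  ultimately show "Suc (card (leaves E')) = card (leaves E)"
    using lv pq \<open>p \<noteq> q\<close> finite_leaves[OF E] by (simp add: card_Diff_subset)
qed


section \<open>Comparing two realizations of a forest\<close>

text \<open>
  The total length of a graph whose vertices are placed by \<open>X\<close>. On an edge \<open>{u, v}\<close> the
  expression \<open>dist (X (Min e)) (X (Max e))\<close> is the distance of \<open>X u\<close> and \<open>X v\<close>.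
\<close>

definition graph_length :: "nat set set \<Rightarrow> (nat \<Rightarrow> 'a::metric_space) \<Rightarrow> real" where
  "graph_length E X = (\<Sum>e\<in>E. dist (X (Min e)) (X (Max e)))"

lemma dist_Min_Max: "dist (X (Min {u, v :: nat})) (X (Max {u, v})) = dist (X u) (X v)"
  by (cases "u \<le> v") (auto simp: min_def max_def dist_commute)

lemma graph_length_nonneg: "graph_length E X \<ge> 0"
  by (simp add: graph_length_def sum_nonneg)

lemma tree_length_eq_graph_length:
  assumes "cubic_forest (edges (fst T))"
  shows "tree_length T = graph_length (edges (fst T)) (snd T)"
  unfolding tree_length_def graph_length_def
proof (rule sum.reindex_bij_witness[where i = "\<lambda>e. (Min e, Max e)" and j = "\<lambda>(u, v). {u, v}"])
  fix e assume e: "e \<in> edges (fst T)"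
  then obtain u v where uv: "u \<noteq> v" "e = {u, v}" using cubic_forestD(2)[OF assms] by blast
  then have "{Min e, Max e} = e" "Min e < Max e"
    by (auto simp: min_def max_def)
  with e show "(case (Min e, Max e) of (u, v) \<Rightarrow> {u, v}) = e"
    "(Min e, Max e) \<in> {(u, v). u < v \<and> {u, v} \<in> edges (fst T)}"
    by auto
qed (auto simp: min_def max_def)

text \<open>
  The angle condition enters only through the lower bound on the distance between two neighbours of
  a vertex of degree three. The factor \<open>K n = (1 + A) * \<mu> ^ n - A\<close> solves the recurrence
  \<open>K (Suc n) = \<mu> * K n + 1 / \<sigma>\<close>, \<open>K 0 = 1\<close>, because \<open>A * (\<mu> - 1) = 1 / \<sigma>\<close>.
\<close>

lemma graph_length_comparison:
  fixes X Y :: "nat \<Rightarrow> 'a::metric_space" and \<sigma> :: real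
  assumes \<sigma>: "0 < \<sigma>" "\<sigma> < 1"
    and "cubic_forest E"
    and "\<And>s a b. degree_in E s = 3 \<Longrightarrow> {s, a} \<in> E \<Longrightarrow> {s, b} \<in> E \<Longrightarrow> a \<noteq> b \<Longrightarrow>
           \<sigma> * (dist (X s) (X a) + dist (X s) (X b)) \<le> dist (X a) (X b)"
    and "\<And>v. v \<in> leaves E \<Longrightarrow> Y v = X v"
    and "card (leaves E) = n"
  defines "\<mu> \<equiv> (1 + 1 / \<sigma>) / 2" and "A \<equiv> 2 / (1 - \<sigma>)"
  shows "graph_length E X \<le> ((1 + A) * \<mu> ^ n - A) * graph_length E Y"
  using assms(3-6)
proof (induction n arbitrary: E Y rule: less_induct)
  case (less n)
  note E = less.prems(1) and wide = less.prems(2) and agree = less.prems(3) and n = less.prems(4)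
  let ?K = "\<lambda>n. (1 + A) * \<mu> ^ n - A"
  have A: "A > 0" and \<mu>: "\<mu> \<ge> 1" and A\<mu>: "A * (\<mu> - 1) = 1 / \<sigma>"
    using \<sigma> by (auto simp: A_def \<mu>_def field_simps)
  have K: "?K m \<ge> 1" for m
    using mult_left_mono[OF one_le_power[OF \<mu>, of m], of "1 + A"] A by (simp add: algebra_simps)
  show ?case
  proof (cases "\<exists>v. degree_in E v = 3")
    case False
    \<comment> \<open>Every edge joins two leaves, so both lengths agree.\<close>
    have "graph_length E X = graph_length E Y"
      unfolding graph_length_def
    proof (rule sum.cong)
      fix e assume e: "e \<in> E"
      then obtain u v where uv: "e = {u, v}" using cubic_forestD(2)[OF E] by blast
      have "w \<in> leaves E" if "w \<in> e" for w
      proof -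
        have "{e \<in> E. w \<in> e} \<noteq> {}" using e that by auto
        then have "degree_in E w \<noteq> 0"
          using cubic_forestD(1)[OF E] by (simp add: degree_in_def)
        with False cubic_forestD(4)[OF E, of w] show ?thesis by (auto simp: leaves_def)
      qed
      then show "dist (X (Min e)) (X (Max e)) = dist (Y (Min e)) (Y (Max e))"
        using agree unfolding uv dist_Min_Max by simp
    qed simp
    with mult_right_mono[OF K[of n] graph_length_nonneg[of E Y]] show ?thesis by simp
  next
    case True
    then obtain s p q where s: "degree_in E s = 3" and "p \<noteq> q"
      and edges: "{s, p} \<in> E" "{s, q} \<in> E" and pq: "p \<in> leaves E" "q \<in> leaves E"
      using two_leaves_at_common_vertex[OF E] by metis
    define E' where "E' = E - {{s, p}, {s, q}}"
    note E' = remove_two_leaves[OF E s \<open>p \<noteq> q\<close> edges pq, folded E'_def]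
    define Y' where "Y' = Y(s := X s)"
    have neq: "s \<noteq> p" "s \<noteq> q" "{s, p} \<noteq> {s, q}"
      using cubic_forest_edge_neq[OF E] edges \<open>p \<noteq> q\<close> by (auto simp: doubleton_eq_iff)
    obtain m where m: "n = Suc m" "card (leaves E') = m" using E'(4) n by metis
    have IH': "graph_length E' X \<le> ?K m * graph_length E' Y'"
    proof (rule less.IH[OF _ E'(1) _ _ m(2)])
      show "m < n" using m(1) by simp
      show "\<sigma> * (dist (X t) (X a) + dist (X t) (X b)) \<le> dist (X a) (X b)"
        if "degree_in E' t = 3" "{t, a} \<in> E'" "{t, b} \<in> E'" "a \<noteq> b" for t a b
        using that by (intro wide E'(3)) (auto simp: E'_def)
      show "Y' v = X v" if "v \<in> leaves E'" for v
        using that agree unfolding E'(2) Y'_def by auto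
    qed
    have split: "graph_length E Z = graph_length E' Z + dist (Z s) (Z p) + dist (Z s) (Z q)"
      for Z :: "nat \<Rightarrow> 'a"
    proof -
      have "graph_length E Z = graph_length E' Z + graph_length {{s, p}, {s, q}} Z"
        unfolding graph_length_def E'_def
        by (rule sum.subset_diff) (use edges cubic_forestD(1)[OF E] in auto)
      moreover have "graph_length {{s, p}, {s, q}} Z = dist (Z s) (Z p) + dist (Z s) (Z q)"
      proof -
        have "(\<Sum>e\<in>{a, b}. f e) = f a + f b" if "a \<noteq> b" for f :: "nat set \<Rightarrow> real" and a b
          using that by simp
        from this[OF neq(3)] show ?thesis by (simp only: graph_length_def dist_Min_Max)
      qed
      ultimately show ?thesis by simp
    qed
    have "s \<in> leaves E'" using E'(2) by simp
    then have card1: "card {e \<in> E'. s \<in> e} = 1"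
      by (simp add: leaves_def degree_in_def)
    \<comment> \<open>Only the edge of \<open>E'\<close> at \<open>s\<close> changes its length, by at most the distance \<open>s\<close> moves.\<close>
    have move: "graph_length E' Y' \<le> graph_length E' Y + dist (X s) (Y s)"
    proof -
      have "graph_length E' Y' \<le>
          (\<Sum>e\<in>E'. dist (Y (Min e)) (Y (Max e)) + (if s \<in> e then dist (X s) (Y s) else 0))"
        unfolding graph_length_def
      proof (rule sum_mono)
        fix e assume "e \<in> E'"
        then obtain u v where uv: "u \<noteq> v" "e = {u, v}" using cubic_forestD(2)[OF E'(1)] by blast
        have "dist (X s) (Y v) \<le> dist (Y s) (Y v) + dist (X s) (Y s)"
          "dist (Y u) (X s) \<le> dist (Y u) (Y s) + dist (X s) (Y s)"
          by metric+
        then show "dist (Y' (Min e)) (Y' (Max e)) \<le>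
            dist (Y (Min e)) (Y (Max e)) + (if s \<in> e then dist (X s) (Y s) else 0)"
          using uv(1) unfolding uv(2) dist_Min_Max Y'_def by auto
      qed
      also have "\<dots> = graph_length E' Y + (\<Sum>e\<in>{e \<in> E'. s \<in> e}. dist (X s) (Y s))"
        using cubic_forestD(1)[OF E'(1)]
        by (simp add: graph_length_def sum.distrib sum.inter_filter del: sum_constant)
      also have "\<dots> = graph_length E' Y + dist (X s) (Y s)"
        using card1 by simp
      finally show ?thesis .
    qed
    have Ypq: "Y p = X p" "Y q = X q" using agree pq by auto
    let ?d = "dist (X p) (X q)"
    let ?x = "dist (X s) (X p) + dist (X s) (X q)"
    let ?y = "dist (Y s) (X p) + dist (Y s) (X q)"
    have x: "?x \<le> 1 / \<sigma> * ?d"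
      using wide[OF s edges \<open>p \<noteq> q\<close>] \<sigma> by (simp add: field_simps)
    have y: "?d \<le> ?y" by metric
    have "dist (X s) (Y s) \<le> dist (X s) (X p) + dist (Y s) (X p)"
      "dist (X s) (Y s) \<le> dist (X s) (X q) + dist (Y s) (X q)"
      by metric+
    then have "2 * dist (X s) (Y s) \<le> ?x + ?y" by simp
    then have new: "graph_length E' Y' \<le> graph_length E Y + (\<mu> - 1) * ?d"
      using move split[of Y] x y unfolding Ypq \<mu>_def by (simp add: field_simps)
    have d: "?d \<le> graph_length E Y"
      using split[of Y] y graph_length_nonneg[of E' Y] unfolding Ypq by linarith
    have "graph_length E X = graph_length E' X + ?x" using split[of X] by simp
    also have "\<dots> \<le> ?K m * (graph_length E Y + (\<mu> - 1) * ?d) + 1 / \<sigma> * ?d"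
      using IH' x mult_left_mono[OF new, of "?K m"] K[of m] by linarith
    also have "\<dots> \<le> ?K m * (graph_length E Y + (\<mu> - 1) * graph_length E Y) +
        1 / \<sigma> * graph_length E Y"
      using d K[of m] \<mu> \<sigma> by (intro add_mono mult_left_mono) auto
    also have "\<dots> = (\<mu> * ?K m + A * (\<mu> - 1)) * graph_length E Y"
      unfolding A\<mu> by (simp add: algebra_simps)
    also have "\<mu> * ?K m + A * (\<mu> - 1) = ?K n"
      unfolding m(1) by (simp add: algebra_simps)
    finally show ?thesis .
  qed
qed


section \<open>Existence of shortest trees\<close>

text \<open>
  Projecting all vertices onto a closed ball that contains the fixed points does not increase the
  length, so it is enough to minimise over a product of compact sets.
\<close>

lemma shortest_realization_exists:
  fixes X :: "nat \<Rightarrow> 'a::euclidean_space"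
  assumes "finite A"
  obtains Y where "\<And>v. v \<in> A \<Longrightarrow> Y v = X v"
    and "\<And>Z. (\<And>v. v \<in> A \<Longrightarrow> Z v = X v) \<Longrightarrow> graph_length E Y \<le> graph_length E Z"
proof -
  have "bounded (X ` A)" using assms by (simp add: finite_imp_bounded)
  then obtain r where r: "\<And>x. x \<in> X ` A \<Longrightarrow> norm x \<le> r" by (auto simp: bounded_iff)
  define B where "B = cball (0::'a) (max 0 r)"
  have B: "compact B" "convex B" "closed B" "B \<noteq> {}" "\<And>v. v \<in> A \<Longrightarrow> X v \<in> B"
    using r by (auto simp: B_def intro: le_max_iff_disj[THEN iffD2])
  define C where "C = (\<Pi>\<^sub>E v\<in>UNIV. if v \<in> A then {X v} else B)"
  have "compactin (product_topology (\<lambda>_. euclidean) UNIV) C"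
    unfolding C_def compactin_PiE using B(1) by simp
  then have "compact C"
    by (simp add: euclidean_product_topology)
  moreover have "(\<lambda>v. if v \<in> A then X v else 0) \<in> C"
    by (auto simp: C_def B_def PiE_def)
  moreover have "continuous_on C (graph_length E)"
    unfolding graph_length_def
    by (intro continuous_intros continuous_on_subset[OF continuous_on_product_coordinates]) auto
  ultimately obtain Y where Y: "Y \<in> C" and least: "\<And>Z. Z \<in> C \<Longrightarrow> graph_length E Y \<le> graph_length E Z"
    using continuous_attains_inf[of C "graph_length E"] by blast
  show ?thesis
  proof (rule that[of Y])
    show "Y v = X v" if "v \<in> A" for v
      using Y that by (auto simp: C_def PiE_iff dest!: spec[of _ v])
    fix Z :: "nat \<Rightarrow> 'a" assume Z: "\<And>v. v \<in> A \<Longrightarrow> Z v = X v"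
    have "closest_point B (Z v) = X v" if "v \<in> A" for v
      using Z[OF that] B(5)[OF that] by (simp add: closest_point_self)
    then have "(\<lambda>v. closest_point B (Z v)) \<in> C"
      using closest_point_in_set[OF B(3,4)] by (auto simp: C_def PiE_def)
    then have "graph_length E Y \<le> graph_length E (\<lambda>v. closest_point B (Z v))"
      by (rule least)
    also have "\<dots> \<le> graph_length E Z"
      unfolding graph_length_def
      by (intro sum_mono closest_point_lipschitz B)
    finally show "graph_length E Y \<le> graph_length E Z" .
  qed
qed


section \<open>Approximate Steiner trees\<close>

text \<open>
  For side lengths \<open>a\<close> and \<open>b\<close> and \<open>t = sin (\<alpha> / 2)\<close>, the law of cosines and
  \<open>cos \<alpha> = 1 - 2 t\<^sup>2\<close> show that the squares of the two sides of the inequality differ by at least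
  \<open>(1 - t\<^sup>2) (a - b)\<^sup>2\<close>.
\<close>

lemma dist_ge_of_angle_ge:
  fixes p q s :: "real ^ 'd::finite"
  assumes "p \<noteq> s" "q \<noteq> s" and \<alpha>: "0 \<le> \<alpha>" "\<alpha> \<le> pi" and angle: "angle_at p s q \<ge> \<alpha>"
  shows "sin (\<alpha> / 2) * (dist s p + dist s q) \<le> dist p q"
proof -
  let ?a = "norm (p - s)" and ?b = "norm (q - s)"
  let ?c = "((p - s) \<bullet> (q - s)) / (?a * ?b)"
  define t where "t = sin (\<alpha> / 2)"
  have ab: "?a > 0" "?b > 0" using assms by auto
  have "\<bar>(p - s) \<bullet> (q - s)\<bar> \<le> ?a * ?b" by (rule Cauchy_Schwarz_ineq2)
  then have "\<bar>?c\<bar> \<le> 1" using ab by (simp add: abs_divide abs_mult field_simps)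
  then have c: "-1 \<le> ?c" "?c \<le> 1"
    using abs_le_D1[of ?c 1] abs_le_D2[of ?c 1] by linarith+
  have "cos (arccos ?c) \<le> cos \<alpha>"
    using angle \<alpha> arccos_ubound[OF c] unfolding angle_at_def by (intro cos_monotone_0_pi_le) auto
  then have "?c \<le> cos \<alpha>" using c by (simp add: cos_arccos)
  also have "cos \<alpha> = 1 - 2 * t\<^sup>2"
    using cos_double_sin[of "\<alpha> / 2"] by (simp add: t_def)
  finally have inner: "(p - s) \<bullet> (q - s) \<le> (1 - 2 * t\<^sup>2) * (?a * ?b)"
    using ab by (simp add: field_simps)
  have "(t * (?a + ?b))\<^sup>2 = ?a\<^sup>2 + ?b\<^sup>2 - 2 * ((1 - 2 * t\<^sup>2) * (?a * ?b)) - (1 - t\<^sup>2) * (?a - ?b)\<^sup>2"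
    by (simp add: power2_eq_square algebra_simps)
  also have "\<dots> \<le> ?a\<^sup>2 + ?b\<^sup>2 - 2 * ((p - s) \<bullet> (q - s))"
  proof -
    have "t\<^sup>2 \<le> 1" by (simp add: t_def abs_square_le_1)
    then have "0 \<le> (1 - t\<^sup>2) * (?a - ?b)\<^sup>2" by simp
    with inner show ?thesis by linarith
  qed
  also have "\<dots> = (dist p q)\<^sup>2"
  proof -
    have "(dist p q)\<^sup>2 = (norm ((p - s) - (q - s)))\<^sup>2" by (simp add: dist_norm)
    then show ?thesis by (simp only: power2_norm_eq_inner inner_diff_left inner_diff_right)
        (simp add: inner_commute algebra_simps)
  qed
  finally have "t * (?a + ?b) \<le> dist p q"
    by (rule power2_le_imp_le) simp
  then show ?thesis by (simp add: t_def dist_norm norm_minus_commute)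
qed

lemma full_steiner_topology_cubic_forest:
  assumes "full_steiner_topology n \<tau>"
  shows "cubic_forest (edges \<tau>)" and "leaves (edges \<tau>) = term_at \<tau> ` {1..n}"
    and "card (leaves (edges \<tau>)) = n"
    and "\<And>s. degree_in (edges \<tau>) s = 3 \<Longrightarrow> s \<in> steiner_points n \<tau>"
proof -
  let ?E = "edges \<tau>" and ?V = "verts \<tau>" and ?t = "term_at \<tau>"
  have graph: "finite ?V" "\<And>e. e \<in> ?E \<Longrightarrow> \<exists>u v. u \<in> ?V \<and> v \<in> ?V \<and> u \<noteq> v \<and> e = {u, v}"
    and acyclic: "\<not> (\<exists>c. graph_cycle ?E c)"
    and inj: "inj_on ?t {1..n}"
    and deg3: "\<And>v. v \<in> ?V \<Longrightarrow> v \<notin> ?t ` {1..n} \<Longrightarrow> degree_in ?E v = 3"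
    and deg1: "\<And>v. v \<in> ?t ` {1..n} \<Longrightarrow> degree_in ?E v = 1"
    using assms unfolding full_steiner_topology_def steiner_topology_def graph_tree_def
      simple_graph_def steiner_points_def by blast+
  have "?E \<subseteq> Pow ?V" using graph(2) by blast
  then have fin: "finite ?E" by (rule finite_subset) (use graph(1) in simp)
  have deg0: "degree_in ?E v = 0" if "v \<notin> ?V" for v
  proof -
    have none: "{e \<in> ?E. v \<in> e} = {}" using graph(2) that by blast
    show ?thesis unfolding degree_in_def none by simp
  qed
  have deg: "degree_in ?E v \<in> {0, 1, 3}" for v
    using deg0[of v] deg1[of v] deg3[of v] by blast
  show "cubic_forest ?E"
    unfolding cubic_forest_def using fin acyclic deg graph(2) by blast
  show lv: "leaves ?E = ?t ` {1..n}"
  proof (intro equalityI subsetI)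
    fix v assume "v \<in> leaves ?E"
    then have "degree_in ?E v = 1" by (simp add: leaves_def)
    with deg0[of v] deg3[of v] show "v \<in> ?t ` {1..n}" by force
  qed (use deg1 in \<open>simp add: leaves_def\<close>)
  then show "card (leaves ?E) = n" using inj by (simp add: card_image)
  fix s assume "degree_in ?E s = 3"
  with deg0[of s] deg1[of s] show "s \<in> steiner_points n \<tau>"
    unfolding steiner_points_def by force
qed

lemma shortest_tree_is_shortest:
  fixes T :: "'d::finite steiner_tree"
  assumes "full_steiner_topology n (fst T)"
  shows "fst (shortest_tree n T) = fst T"
    and "\<And>v. v \<in> leaves (edges (fst T)) \<Longrightarrow> snd (shortest_tree n T) v = snd T v"
    and "tree_length (shortest_tree n T) \<le> tree_length T"
proof -
  note forest = full_steiner_topology_cubic_forest[OF assms]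
  let ?P = "\<lambda>T'. fst T' = fst T \<and>
     (\<forall>i\<in>{1..n}. snd T' (term_at (fst T) i) = snd T (term_at (fst T) i))"
  have P: "?P T' \<longleftrightarrow> fst T' = fst T \<and> (\<forall>v\<in>leaves (edges (fst T)). snd T' v = snd T v)"
    for T' :: "'d steiner_tree"
    unfolding forest(2) by auto
  obtain Y where Y: "\<And>v. v \<in> leaves (edges (fst T)) \<Longrightarrow> Y v = snd T v"
    and least: "\<And>Z. (\<And>v. v \<in> leaves (edges (fst T)) \<Longrightarrow> Z v = snd T v) \<Longrightarrow>
      graph_length (edges (fst T)) Y \<le> graph_length (edges (fst T)) Z"
    using shortest_realization_exists[OF finite_leaves[OF forest(1)]] by blast
  have "is_arg_min tree_length ?P (fst T, Y)"
    unfolding is_arg_min_linorder P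
    using Y least forest(1) by (auto simp: tree_length_eq_graph_length)
  then have "is_arg_min tree_length ?P (shortest_tree n T)"
    unfolding shortest_tree_def arg_min_def by (rule someI)
  then have S: "?P (shortest_tree n T)"
    and min: "\<And>T'. ?P T' \<Longrightarrow> tree_length (shortest_tree n T) \<le> tree_length T'"
    unfolding is_arg_min_linorder by blast+
  show "fst (shortest_tree n T) = fst T" using S by blast
  show "snd (shortest_tree n T) v = snd T v" if "v \<in> leaves (edges (fst T))" for v
    using S that unfolding P by blast
  show "tree_length (shortest_tree n T) \<le> tree_length T" by (rule min) simp
qed

lemma tree_length_le_shortest_tree:
  fixes T :: "'d::finite steiner_tree"
  assumes \<epsilon>: "0 < \<epsilon>" "\<epsilon> < 2 * pi / 3" and T: "T \<in> full_approx_steiner_trees \<epsilon> n"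
  defines "\<sigma> \<equiv> sin (pi / 3 - \<epsilon> / 2)"
  shows "tree_length T \<le> (1 + 2 / (1 - \<sigma>)) * ((1 + 1 / \<sigma>) / 2) ^ n * tree_length (shortest_tree n T)"
proof -
  let ?E = "edges (fst T)" and ?S = "shortest_tree n T"
  have full: "full_steiner_topology n (fst T)" and approx: "approx_steiner_tree \<epsilon> n T"
    using T by (auto simp: full_approx_steiner_trees_def)
  note forest = full_steiner_topology_cubic_forest[OF full]
  note S = shortest_tree_is_shortest[OF full]
  have \<sigma>: "0 < \<sigma>" "\<sigma> < 1"
  proof -
    show "0 < \<sigma>" unfolding \<sigma>_def using \<epsilon> by (intro sin_gt_zero) auto
    have "\<sigma> < sin (pi / 2)"
      unfolding \<sigma>_def using \<epsilon> by (intro sin_monotone_2pi) auto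
    then show "\<sigma> < 1" by simp
  qed
  have half: "(2 * pi / 3 - \<epsilon>) / 2 = pi / 3 - \<epsilon> / 2" by simp
  have "graph_length ?E (snd T) \<le>
      ((1 + 2 / (1 - \<sigma>)) * ((1 + 1 / \<sigma>) / 2) ^ n - 2 / (1 - \<sigma>)) * graph_length ?E (snd ?S)"
  proof (rule graph_length_comparison[OF \<sigma> forest(1) _ S(2) forest(3)])
    fix s a b assume s: "degree_in ?E s = 3" and ab: "{s, a} \<in> ?E" "{s, b} \<in> ?E" "a \<noteq> b"
    have "s \<in> steiner_points n (fst T)" using forest(4)[OF s] .
    then have "snd T a \<noteq> snd T s" "snd T b \<noteq> snd T s"
      and "angle_at (snd T a) (snd T s) (snd T b) \<ge> 2 * pi / 3 - \<epsilon>"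
      using approx ab unfolding approx_steiner_tree_def by auto
    then show "\<sigma> * (dist (snd T s) (snd T a) + dist (snd T s) (snd T b)) \<le> dist (snd T a) (snd T b)"
      using dist_ge_of_angle_ge[of "snd T a" "snd T s" "snd T b" "2 * pi / 3 - \<epsilon>"] \<epsilon>
      unfolding \<sigma>_def half by simp
  qed
  also have "\<dots> \<le> (1 + 2 / (1 - \<sigma>)) * ((1 + 1 / \<sigma>) / 2) ^ n * graph_length ?E (snd ?S)"
    by (rule mult_right_mono[OF _ graph_length_nonneg]) (use \<sigma> in simp)
  finally show ?thesis
    using forest(1) S(1) by (simp add: tree_length_eq_graph_length)
qed

text \<open>
  With \<open>y = (\<pi>/3 - x)/2\<close>, this is \<open>1 + sin 2y \<le> 2 cos x = cos 2y + sqrt 3 sin 2y\<close>, or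
  \<open>tan y \<le> sqrt 3 - 1\<close>, which holds for \<open>y \<le> \<pi>/6\<close>.
\<close>

lemma growth_rate_le:
  fixes x :: real
  assumes "0 < x" "x < pi / 3"
  shows "(1 + 1 / sin (pi / 3 - x)) / 2 \<le> cos x / sin (pi / 3 - x)"
proof -
  define y where "y = (pi / 3 - x) / 2"
  have y: "0 < y" "y < pi / 6" using assms by (auto simp: y_def)
  have x: "x = pi / 3 - 2 * y" by (simp add: y_def field_simps)
  have s: "0 < sin y" "sin y \<le> 1 / 2"
    using y sin_monotone_2pi_le[of y "pi / 6"] by (auto intro!: sin_gt_zero simp: sin_30)
  have c: "sqrt 3 / 2 \<le> cos y"
    using y cos_monotone_0_pi_le[of y "pi / 6"] by (auto simp: cos_30)
  have "1 \<le> sqrt (3::real)" by simp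
  have "sqrt 3 \<le> (2::real)" by (rule real_le_lsqrt) auto
  have "1 / 2 \<le> (sqrt 3 - 1) * (sqrt 3 / 2)"
    using \<open>sqrt 3 \<le> 2\<close> by (simp add: algebra_simps)
  also have "\<dots> \<le> (sqrt 3 - 1) * cos y"
    using c \<open>1 \<le> sqrt 3\<close> by (intro mult_left_mono) auto
  finally have "sin y \<le> (sqrt 3 - 1) * cos y" using s by linarith
  then have "2 * sin y * sin y \<le> 2 * sin y * ((sqrt 3 - 1) * cos y)"
    using s by (intro mult_left_mono) auto
  moreover have "2 * cos x = cos (2 * y) + sqrt 3 * sin (2 * y)"
    unfolding x cos_diff cos_60 sin_60 by simp
  moreover have "cos (2 * y) = 1 - 2 * sin y * sin y"
    by (simp add: cos_double_sin power2_eq_square)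
  moreover have "sin (2 * y) = 2 * sin y * cos y" by (rule sin_double)
  ultimately have "1 + sin (2 * y) \<le> 2 * cos x" by (simp add: algebra_simps)
  moreover have "sin (2 * y) > 0" using y by (intro sin_gt_zero) auto
  moreover have "pi / 3 - x = 2 * y" by (simp add: y_def)
  ultimately show ?thesis by (simp only:) (simp add: divide_simps)
qed

theorem theorem6p4:
  fixes \<epsilon> :: real
  assumes "0 < \<epsilon>" and "\<epsilon> < 2 * pi / 3"
    and "CARD('d::finite) \<ge> 2"
  shows "(\<forall>\<^sub>F n in sequentially. max_relative_error TYPE('d) \<epsilon> n < \<infinity>) \<and>
         (\<lambda>n. real_of_ereal (max_relative_error TYPE('d) \<epsilon> n))
           \<in> O(\<lambda>n. (cos (\<epsilon> / 2) / sin (pi / 3 - \<epsilon> / 2)) ^ n)"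
proof -
  define \<sigma> where "\<sigma> = sin (pi / 3 - \<epsilon> / 2)"
  define \<rho> where "\<rho> = cos (\<epsilon> / 2) / \<sigma>"
  define C where "C = 1 + 2 / (1 - \<sigma>)"
  have "0 < \<sigma>" unfolding \<sigma>_def using assms by (intro sin_gt_zero) auto
  have "\<sigma> \<le> 1" by (simp add: \<sigma>_def)
  then have C: "C \<ge> 0" by (simp add: C_def)
  have rate: "(1 + 1 / \<sigma>) / 2 \<le> \<rho>"
    using growth_rate_le[of "\<epsilon> / 2"] assms by (simp add: \<rho>_def \<sigma>_def)
  then have "\<rho> \<ge> 0" using \<open>0 < \<sigma>\<close> by (smt (verit) divide_nonneg_nonneg)
  let ?F = "\<lambda>n. max_relative_error TYPE('d) \<epsilon> n"
  let ?r = "\<lambda>n (T :: 'd steiner_tree). (tree_length T - tree_length (shortest_tree n T)) /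
      tree_length (shortest_tree n T)"
  have r: "0 \<le> ?r n T \<and> ?r n T \<le> C * \<rho> ^ n"
    if T: "T \<in> full_approx_steiner_trees \<epsilon> n" for n and T :: "'d steiner_tree"
  proof -
    let ?l = "tree_length (shortest_tree n T)"
    have "full_steiner_topology n (fst T)"
      using T by (auto simp: full_approx_steiner_trees_def)
    then have le: "?l \<le> tree_length T" by (rule shortest_tree_is_shortest)
    have l: "?l \<ge> 0"
      unfolding tree_length_def by (intro sum_nonneg) auto
    have "C * ((1 + 1 / \<sigma>) / 2) ^ n * ?l \<le> C * \<rho> ^ n * ?l"
      using rate C l \<open>0 < \<sigma>\<close> by (intro mult_right_mono mult_left_mono power_mono) auto
    with tree_length_le_shortest_tree[OF assms(1,2) T]
    have "tree_length T \<le> C * \<rho> ^ n * ?l"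
      by (simp add: C_def \<sigma>_def)
    with le l C \<open>\<rho> \<ge> 0\<close> show ?thesis
      by (cases "?l = 0") (auto simp: field_simps)
  qed
  have upper: "?F n \<le> ereal (C * \<rho> ^ n)" for n
    unfolding max_relative_error_def using r by (intro SUP_least) auto
  \<comment> \<open>If there are no trees at all, then the supremum is \<open>- \<infinity>\<close>, which becomes the real number 0.\<close>
  have "\<bar>real_of_ereal (?F n)\<bar> \<le> C * \<rho> ^ n" for n
  proof (cases "(full_approx_steiner_trees \<epsilon> n :: ('d steiner_tree) set) = {}")
    case True
    then show ?thesis
      using C \<open>\<rho> \<ge> 0\<close> by (simp add: max_relative_error_def bot_ereal_def)
  next
    case False
    then obtain T :: "'d steiner_tree" where T: "T \<in> full_approx_steiner_trees \<epsilon> n" by blast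
    have "0 \<le> ereal (?r n T)" using r[OF T] by simp
    also have "\<dots> \<le> ?F n" unfolding max_relative_error_def using T by (rule SUP_upper)
    finally have "0 \<le> ?F n" .
    with upper[of n] show ?thesis by (cases "?F n") auto
  qed
  then have "(\<lambda>n. real_of_ereal (?F n)) \<in> O(\<lambda>n. \<rho> ^ n)"
    using \<open>\<rho> \<ge> 0\<close> by (intro bigoI[of _ C] always_eventually) simp
  moreover have "?F n < \<infinity>" for n
    using upper[of n] by (auto simp: less_top[symmetric] top_ereal_def)
  ultimately show ?thesis by (simp add: \<rho>_def \<sigma>_def)
qed

end
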